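(* Let $G$ be a connected graph on $n$ vertices with $m$ edges and $\operatorname{diam}(G)=2$. Then $$\mathcal K(G)\le (3+\sqrt5)(n-1).$$ In particular, $\mathcal K(G)=O(n)$ (with an absolute implied constant).
   Context: All graphs are finite, simple, undirected and unweighted. $d_G(u)$ denotes the degree of $u$. The diameter $\operatorname{diam}(G)$ of a connected graph is the maximum shortest-path distance between two of its vertices. For a connected graph $G$ with $m\ge 1$ edges, Kemeny's constant is $\mathcal K(G)=\sum_{j\in V(G)}\frac{d_G(j)}{2m}E_iT_j$, where $E_iT_j$ is the expected hitting time of $j$ for the simple random walk on $G$ started at $i$ (with $E_iT_i=0$); this does not depend on $i$. Equivalently, $\mathcal K(G)=\frac1{4m}\sum_{u\in V(G)}\sum_{v\in V(G)}d_G(u)d_G(v)r_G(u,v)$, where $r_G(u,v)$ is the effective resistance between $u$ and $v$ when each edge is a $1$-ohm resistor; also equivalently, $\mathcal K(G)=\sum_{i=2}^n 1/\lambda_i$, where $0=\lambda_1<\lambda_2\le\dots\le\lambda_n$ are the eigenvalues of the normalized Laplacian $I-D^{-1/2}AD^{-1/2}$ ($A$ the adjacency matrix and $D$ the diagonal degree matrix of $G$). *)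

theory Defs
  imports "HOL-Probability.Probability" "Graph_Theory.Graph_Theory"
begin

text \<open>
  A finite simple undirected graph is a \<^locale>\<open>pair_graph\<close>: a finite loop-free digraph whose
  arcs are ordered pairs and whose arc relation is symmetric. Each edge is thus represented by
  two arcs, and the degree of a vertex is its \<^const>\<open>out_degree\<close>.
\<close>

definition edge_set :: "'a pair_pre_digraph \<Rightarrow> 'a set set" where
  "edge_set G = {{u, v} | u v. (u, v) \<in> parcs G}"

definition neighbours :: "'a pair_pre_digraph \<Rightarrow> 'a \<Rightarrow> 'a set" where
  "neighbours G u = {v. (u, v) \<in> parcs G}"

text \<open>With unit arc weights the library's shortest-path cost is the number of arcs of a shortest walk.\<close>

definition graph_dist :: "'a pair_pre_digraph \<Rightarrow> 'a \<Rightarrow> 'a \<Rightarrow> ereal" where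
  "graph_dist G u v = wf_digraph.\<mu> G (\<lambda>_. 1) u v"

definition graph_diam :: "'a pair_pre_digraph \<Rightarrow> ereal" where
  "graph_diam G = (SUP (u, v) \<in> pverts G \<times> pverts G. graph_dist G u v)"

text \<open>
  The simple random walk from \<open>i\<close>, as a probability measure on infinite trajectories: the
  Ionescu-Tulcea extension of the kernels giving the law of the position at time \<open>n\<close> from the
  positions at times \<open>0, \<dots>, n - 1\<close>. The kernel is meaningless at a vertex without neighbours,
  which is never reached from a vertex of a connected graph that has an edge.
\<close>

definition srw_kernel :: "'a pair_pre_digraph \<Rightarrow> 'a \<Rightarrow> nat \<Rightarrow> (nat \<Rightarrow> 'a) \<Rightarrow> 'a measure" where
  "srw_kernel G i n \<omega> =
     (if n = 0 then measure_pmf (return_pmf i)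
      else measure_pmf (pmf_of_set (neighbours G (\<omega> (n - 1)))))"

definition srw :: "'a pair_pre_digraph \<Rightarrow> 'a \<Rightarrow> (nat \<Rightarrow> 'a) measure" where
  "srw G i = projective_family.lim UNIV
     (Ionescu_Tulcea.CI (srw_kernel G i) (\<lambda>_. count_space UNIV)) (\<lambda>_. count_space UNIV)"

lemma Ionescu_Tulcea_srw_kernel: "Ionescu_Tulcea (srw_kernel G i) (\<lambda>_. count_space UNIV)"
proof (rule Ionescu_Tulcea.intro)
  fix n
  show "srw_kernel G i n \<in> measurable (PiM {0..<n} (\<lambda>_. count_space UNIV)) (subprob_algebra (count_space UNIV))"
  proof (cases n)
    case 0
    then have "srw_kernel G i n = (\<lambda>_. measure_pmf (return_pmf i))"
      by (auto simp: srw_kernel_def)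
    then show ?thesis
      by (simp add: space_subprob_algebra measure_pmf.subprob_space_axioms)
  next
    case (Suc m)
    have "(\<lambda>\<omega>. \<omega> m) \<in> measurable (PiM {0..<n} (\<lambda>_. count_space UNIV)) (count_space (UNIV :: 'a set))"
      using Suc by (intro measurable_component_singleton) auto
    then have "(\<lambda>\<omega>. measure_pmf (pmf_of_set (neighbours G (\<omega> m))))
        \<in> measurable (PiM {0..<n} (\<lambda>_. count_space UNIV)) (subprob_algebra (count_space UNIV))"
      by (rule measurable_compose)
         (simp add: space_subprob_algebra measure_pmf.subprob_space_axioms)
    moreover have "srw_kernel G i n = (\<lambda>\<omega>. measure_pmf (pmf_of_set (neighbours G (\<omega> m))))"
      using Suc by (auto simp: srw_kernel_def)
    ultimately show ?thesis by (simp only:)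
  qed
next
  show "prob_space (srw_kernel G i n \<omega>)" for n \<omega>
    unfolding srw_kernel_def by (cases "n = 0") (simp_all only: simp_thms if_True if_False measure_pmf.prob_space_axioms)
qed

lemma sets_srw: "sets (srw G i) = sets (PiM UNIV (\<lambda>_. count_space UNIV))"
proof -
  interpret Ionescu_Tulcea "srw_kernel G i" "\<lambda>_. count_space UNIV"
    by (rule Ionescu_Tulcea_srw_kernel)
  show ?thesis by (simp add: srw_def)
qed

text \<open>The walk starts at \<open>i\<close>, and its finite-dimensional laws are products of transition probabilities.\<close>

lemma emeasure_srw_path:
  "emeasure (srw G i) {\<omega>. \<forall>k<Suc n. \<omega> k = x k} =
     ennreal (of_bool (x 0 = i) * (\<Prod>k<n. pmf (pmf_of_set (neighbours G (x k))) (x (Suc k))))"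
proof -
  let ?M = "\<lambda>_ :: nat. count_space (UNIV :: 'a set)"
  interpret Ionescu_Tulcea "srw_kernel G i" ?M
    by (rule Ionescu_Tulcea_srw_kernel)
  let ?u = "\<lambda>_ :: nat. undefined :: 'a"
  let ?r = "\<lambda>n. restrict x {0..<n}"
  have r: "{?r n} \<in> sets (PiM {0..<n} ?M)" for n
  proof -
    have "{?r n} = PiE {0..<n} (\<lambda>k. {?r n k})"
      by (rule PiE_singleton[symmetric]) (rule restrict_extensional)
    also have "\<dots> \<in> sets (PiM {0..<n} ?M)"
      by (rule sets_PiM_I_finite) simp_all
    finally show ?thesis .
  qed
  have u: "?u \<in> space (PiM {0..<0} ?M)" by (auto simp: space_PiM)
  have step: "emeasure (C 0 (Suc n) ?u) {?r (Suc n)} =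
      emeasure (C 0 n ?u) {?r n} * emeasure (srw_kernel G i n (?r n)) {x n}" for n
  proof -
    have "emeasure (C 0 (Suc n) ?u) {?r (Suc n)} =
        (\<integral>\<^sup>+\<omega>. emeasure (eP n \<omega>) {?r (Suc n)} \<partial>C 0 n ?u)"
      unfolding C.simps(2) add_0
    proof (rule emeasure_bind[where N = "PiM {0..<Suc n} ?M"])
      show "space (C 0 n ?u) \<noteq> {}"
        using prob_space.not_empty[OF prob_space_C[OF u]] .
      show "eP n \<in> measurable (C 0 n ?u) (subprob_algebra (PiM {0..<Suc n} ?M))"
        unfolding measurable_cong_sets[OF sets_C[OF u, of n, unfolded add_0] refl]
        by (rule measurable_eP)
    qed (rule r)
    also have "\<dots> = (\<integral>\<^sup>+\<omega>. emeasure (srw_kernel G i n (?r n)) {x n} * indicator {?r n} \<omega> \<partial>C 0 n ?u)"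
    proof (rule nn_integral_cong)
      fix \<omega> assume "\<omega> \<in> space (C 0 n ?u)"
      then have w: "\<omega> \<in> space (PiM {0..<n} ?M)" using space_C[OF u] by simp
      have eq: "(\<lambda>y. fun_upd \<omega> n y) -` {?r (Suc n)} = (if \<omega> = ?r n then {x n} else {})"
      proof -
        have iff: "fun_upd \<omega> n y = ?r (Suc n) \<longleftrightarrow> \<omega> = ?r n \<and> y = x n" for y
        proof
          assume a: "fun_upd \<omega> n y = ?r (Suc n)"
          have "\<omega> k = ?r n k" for k
            using fun_cong[OF a, of k] w
            by (cases "k = n") (auto simp: space_PiM PiE_def extensional_def restrict_def split: if_splits)
          then show "\<omega> = ?r n \<and> y = x n" using fun_cong[OF a, of n] by (auto simp: restrict_def)
        next
          assume a: "\<omega> = ?r n \<and> y = x n"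
          show "fun_upd \<omega> n y = ?r (Suc n)"
          proof
            show "(fun_upd \<omega> n y) k = ?r (Suc n) k" for k
              using a by (cases "k = n") (auto simp: restrict_def)
          qed
        qed
        show ?thesis
          unfolding vimage_def singleton_iff iff
          by (cases "\<omega> = ?r n") (simp_all only: simp_thms if_True if_False singleton_conv Collect_empty_eq)
      qed
      show "emeasure (eP n \<omega>) {?r (Suc n)} =
          emeasure (srw_kernel G i n (?r n)) {x n} * indicator {?r n} \<omega>"
        using emeasure_eP[OF w r[of "Suc n"]] by (simp add: eq)
    qed
    also have "\<dots> = emeasure (srw_kernel G i n (?r n)) {x n} * emeasure (C 0 n ?u) {?r n}"
      by (rule nn_integral_cmult_indicator) (simp only: sets_C[OF u] add_0 r)
    finally show ?thesis by (simp add: mult.commute)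
  qed
  have C0: "emeasure (C 0 0 ?u) {?r 0} = 1"
    unfolding C.simps(1) by (subst emeasure_return) (auto simp: restrict_def intro: r[of 0, simplified])
  have main: "emeasure (C 0 (Suc n) ?u) {?r (Suc n)} =
      ennreal (of_bool (x 0 = i) * (\<Prod>k<n. pmf (pmf_of_set (neighbours G (x k))) (x (Suc k))))"
  proof (induction n)
    case 0
    show ?case
      unfolding step[of 0] C0
      by (auto simp: srw_kernel_def emeasure_pmf_single indicator_def)
  next
    case (Suc n)
    show ?case
      unfolding step[of "Suc n"] Suc
      by (simp add: srw_kernel_def emeasure_pmf_single ennreal_mult'[symmetric] mult_ac prod_nonneg
        flip: ennreal_mult')
  qed
  have "{\<omega>. \<forall>k<Suc n. \<omega> k = x k} = prod_emb UNIV ?M {0..<Suc n} {?r (Suc n)}"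
    by (auto simp: prod_emb_def fun_eq_iff restrict_def)
       (metis less_Suc_eq_le atLeastLessThan_iff le0)+
  then have "emeasure (srw G i) {\<omega>. \<forall>k<Suc n. \<omega> k = x k} = emeasure (CI {0..<Suc n}) {?r (Suc n)}"
    unfolding srw_def by (simp only:) (rule lim[OF _ r], simp)
  also have "\<dots> = emeasure (C 0 (Suc n) ?u) (prod_emb {0..<Suc n} ?M {0..<Suc n} {?r (Suc n)})"
    by (rule emeasure_CI[OF subset_refl r])
  also have "prod_emb {0..<Suc n} ?M {0..<Suc n} {?r (Suc n)} = {?r (Suc n)}"
    by (rule prod_emb_id) auto
  finally show ?thesis using main by simp
qed

text \<open>The infimum over the empty set is \<open>\<infinity>\<close>, so a trajectory missing \<open>j\<close> has hitting time \<open>\<infinity>\<close>.\<close>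

definition hitting_time :: "'a \<Rightarrow> (nat \<Rightarrow> 'a) \<Rightarrow> ennreal" where
  "hitting_time j \<omega> = (INF n \<in> {n. \<omega> n = j}. of_nat n)"

definition expected_hitting_time :: "'a pair_pre_digraph \<Rightarrow> 'a \<Rightarrow> 'a \<Rightarrow> ennreal" where
  "expected_hitting_time G i j = (\<integral>\<^sup>+ \<omega>. hitting_time j \<omega> \<partial>srw G i)"

text \<open>
  The defining sum of Kemeny's constant for the starting vertex \<open>i\<close>. For connected \<open>G\<close> it does not
  depend on \<open>i\<close>; keeping \<open>i\<close> as an argument avoids building that fact into the definition.
\<close>

definition kemeny :: "'a pair_pre_digraph \<Rightarrow> 'a \<Rightarrow> ennreal" where
  "kemeny G i = (\<Sum>j\<in>pverts G.
     ennreal (real (out_degree G j) / (2 * real (card (edge_set G)))) * expected_hitting_time G i j)"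

end

theory Submission
  imports Defs
begin

text \<open>Let \<open>h\<^sub>j(i)\<close> be the expected time to reach \<open>j\<close> from \<open>i\<close>, and \<open>vol = 2m\<close> the sum of the degrees.
  Kemeny's constant is \<open>(\<Sum>j. deg j * h\<^sub>j(i)) / vol\<close>, it does not depend on \<open>i\<close>, and averaging it over the
  stationary distribution turns it into \<open>(\<Sum>u v. deg u * deg v * C(u, v)) / (2 * vol\<^sup>2)\<close>, where
  \<open>C(u, v) = h\<^sub>v(u) + h\<^sub>u(v)\<close> is the commute time, that is, \<open>vol\<close> times the effective resistance.

  The point is that in a graph of diameter at most two the effective resistance between \<open>u\<close> and \<open>v\<close> is at
  most \<open>4 * (1 / deg u + 1 / deg v)\<close>: send a unit current from \<open>u\<close> evenly to all neighbours of \<open>u\<close>, and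
  let it arrive at \<open>v\<close> evenly from all neighbours of \<open>v\<close>. Every neighbour \<open>a\<close> of \<open>u\<close> is joined to every
  neighbour \<open>b\<close> of \<open>v\<close> by a path with at most two edges, so the middle part of the current consists of a
  stage leaving the vertices \<open>a\<close>, each of which emits \<open>1 / deg u\<close>, and a stage entering the vertices \<open>b\<close>.
  However these paths overlap, the squares of the currents leaving one vertex add up to at most the square
  of their total, so each of the first two stages dissipates at most \<open>1 / deg u\<close>, and each of the last two
  at most \<open>1 / deg v\<close>. The first two stages run along different arcs, and opposite currents on an edge
  only cancel, so they dissipate at most \<open>2 / deg u\<close> together; the last two likewise; and superposing the
  two halves at most doubles the sum. Lemma
  \<open>resistance_bound\<close> is the dual form of this argument, phrased with potentials instead of currents.

  Summing over \<open>u \<noteq> v\<close> the bound \<open>deg u * deg v * C(u, v) \<le> 4 * vol * (deg u + deg v)\<close> of lemma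
  \<open>commute_bound\<close> gives \<open>4 * (n - 1)\<close> for Kemeny's constant (\<open>weighted_hitting_sum_bound\<close>), and
  \<open>4 \<le> 3 + sqrt 5\<close>.

  All of this takes place in real linear algebra, where \<open>h\<^sub>j\<close> is a nonnegative solution of the one-step
  equations \<open>h\<^sub>j(j) = 0\<close> and \<open>h\<^sub>j(x) = 1 + avg\<^sub>y h\<^sub>j(y)\<close> for \<open>x \<noteq> j\<close>, the average being over the neighbours \<open>y\<close>
  of \<open>x\<close>. The random walk itself enters only through \<open>expected_hitting_time_le\<close>: the expected hitting
  time is at most any nonnegative solution of these equations.\<close>

section \<open>Laplacian and energy of a finite graph\<close>

locale finite_graph =
  fixes V :: "'a set" and N :: "'a \<Rightarrow> 'a set"
  assumes finite_V: "finite V"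
    and N_subset: "x \<in> V \<Longrightarrow> N x \<subseteq> V"
    and N_sym: "y \<in> N x \<Longrightarrow> x \<in> N y"
    and N_irrefl: "x \<notin> N x"
begin

definition deg :: "'a \<Rightarrow> real" where
  "deg x = real (card (N x))"

definition vol :: real where
  "vol = (\<Sum>x\<in>V. deg x)"

definition lap :: "('a \<Rightarrow> real) \<Rightarrow> 'a \<Rightarrow> real" where
  "lap \<phi> x = (\<Sum>y\<in>N x. \<phi> x - \<phi> y)"

text \<open>Dirichlet energy is usually a sum of \<open>(\<phi> x - \<phi> y)\<^sup>2\<close> over edges. Counting only the downhill direction of
  each edge gives the same total, but splits it into contributions of the individual vertices. This is
  what prevents an edge from being charged from both of its ends in \<open>cheap_neighbour\<close>.\<close>

definition descent :: "('a \<Rightarrow> real) \<Rightarrow> 'a \<Rightarrow> real" where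
  "descent \<phi> x = (\<Sum>y\<in>N x. (max 0 (\<phi> x - \<phi> y))\<^sup>2)"

definition energy :: "('a \<Rightarrow> real) \<Rightarrow> real" where
  "energy \<phi> = (\<Sum>x\<in>V. descent \<phi> x)"

lemma finite_N: "x \<in> V \<Longrightarrow> finite (N x)"
  using N_subset finite_V finite_subset by blast

lemma N_in_V: "x \<in> V \<Longrightarrow> y \<in> N x \<Longrightarrow> y \<in> V"
  using N_subset by blast

text \<open>Reversing arcs permutes the arcs of a symmetric graph; this is all the summation by parts below rests on.\<close>

lemma sum_arcs_swap:
  "(\<Sum>x\<in>V. \<Sum>y\<in>N x. f x y) = (\<Sum>x\<in>V. \<Sum>y\<in>N x. f y x :: real)"
proof -
  have *: "N x = {y \<in> V. y \<in> N x}" "N x = {y \<in> V. x \<in> N y}" if "x \<in> V" for x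
    using N_in_V N_sym that by blast+
  have "(\<Sum>x\<in>V. \<Sum>y\<in>N x. f x y) = (\<Sum>x\<in>V. \<Sum>y\<in>{y \<in> V. y \<in> N x}. f x y)"
    using *(1) by (intro sum.cong) auto
  also have "\<dots> = (\<Sum>y\<in>V. \<Sum>x\<in>{x \<in> V. y \<in> N x}. f x y)"
    by (rule sum.swap_restrict[OF finite_V finite_V])
  also have "\<dots> = (\<Sum>y\<in>V. \<Sum>x\<in>N y. f x y)"
    using *(2) by (intro sum.cong) auto
  finally show ?thesis .
qed

lemma lap_deg: "lap \<phi> x = deg x * \<phi> x - (\<Sum>y\<in>N x. \<phi> y)"
  by (simp add: lap_def sum_subtractf deg_def)

lemma sum_lap: "(\<Sum>x\<in>V. lap \<phi> x) = 0"
  using sum_arcs_swap[of "\<lambda>x y. \<phi> x"] by (simp add: lap_def sum_subtractf)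

text \<open>Summation by parts: averaging an arc with its reverse turns \<open>\<phi> x * (\<phi> x - \<phi> y)\<close> into \<open>(\<phi> x - \<phi> y)\<^sup>2 / 2\<close>,
  and exactly one of the two directions of an edge with \<open>\<phi> x \<noteq> \<phi> y\<close> is downhill.\<close>

lemma green: "(\<Sum>x\<in>V. \<phi> x * lap \<phi> x) = energy \<phi>"
proof -
  have swap: "(\<Sum>x\<in>V. \<Sum>y\<in>N x. \<phi> y * \<phi> y) = (\<Sum>x\<in>V. \<Sum>y\<in>N x. \<phi> x * \<phi> x)"
    by (rule sum_arcs_swap)
  have "2 * energy \<phi> = energy \<phi> + (\<Sum>x\<in>V. \<Sum>y\<in>N x. (max 0 (\<phi> y - \<phi> x))\<^sup>2)"
    unfolding energy_def descent_def
    using sum_arcs_swap[of "\<lambda>x y. (max 0 (\<phi> x - \<phi> y))\<^sup>2"] by simp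
  also have "\<dots> = (\<Sum>x\<in>V. \<Sum>y\<in>N x. (\<phi> x - \<phi> y)\<^sup>2)"
    unfolding energy_def descent_def sum.distrib[symmetric]
    by (intro sum.cong refl) (auto simp: max_def power2_eq_square algebra_simps)
  also have "\<dots> = (\<Sum>x\<in>V. \<Sum>y\<in>N x. 2 * (\<phi> x * (\<phi> x - \<phi> y)) + \<phi> y * \<phi> y - \<phi> x * \<phi> x)"
    by (intro sum.cong refl) (auto simp: power2_eq_square algebra_simps)
  also have "\<dots> = 2 * (\<Sum>x\<in>V. \<phi> x * lap \<phi> x)"
  proof -
    have "(\<Sum>x\<in>V. \<Sum>y\<in>N x. 2 * (\<phi> x * (\<phi> x - \<phi> y))) = 2 * (\<Sum>x\<in>V. \<phi> x * lap \<phi> x)"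
      by (simp only: lap_def sum_distrib_left)
    then show ?thesis by (simp only: sum.distrib sum_subtractf swap)
  qed
  finally show ?thesis by simp
qed

lemma descent_nonneg: "0 \<le> descent \<phi> x"
  unfolding descent_def by (intro sum_nonneg) simp

lemma energy_nonneg: "0 \<le> energy \<phi>"
  unfolding energy_def by (intro sum_nonneg descent_nonneg)

lemma energy_uminus: "energy (\<lambda>x. - \<phi> x) = energy \<phi>"
  unfolding energy_def descent_def
  using sum_arcs_swap[of "\<lambda>x y. (max 0 (\<phi> x - \<phi> y))\<^sup>2"] by (simp add: algebra_simps)

lemma drop_le_descent:
  assumes "x \<in> V" "y \<in> N x"
  shows "\<phi> x - \<phi> y \<le> sqrt (descent \<phi> x)"
proof -
  have "(max 0 (\<phi> x - \<phi> y))\<^sup>2 \<le> descent \<phi> x"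
    unfolding descent_def using assms by (intro member_le_sum) (auto simp: finite_N)
  then have "max 0 (\<phi> x - \<phi> y) \<le> sqrt (descent \<phi> x)"
    by (rule real_le_rsqrt)
  then show ?thesis by simp
qed

text \<open>The first half of the way from \<open>u\<close> to \<open>v\<close>: a step to a neighbour \<open>a\<close> of \<open>u\<close>, followed by a step out of
  \<open>a\<close>, whose potential drop is at most the square root of the descent at \<open>a\<close>. The arcs from \<open>u\<close> to its
  neighbours and the arcs out of these neighbours are pairwise distinct, so the squares of these drops,
  summed over all neighbours \<open>a\<close>, stay within twice the energy, and some \<open>a\<close> is at most average.\<close>

lemma cheap_neighbour:
  assumes "u \<in> V" "N u \<noteq> {}"
  obtains a s where "a \<in> N u" "0 \<le> s" "\<phi> u - \<phi> a + sqrt (descent \<phi> a) \<le> s"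
    "deg u * s\<^sup>2 \<le> 2 * energy \<phi>"
proof -
  define s where "s a = max 0 (\<phi> u - \<phi> a) + sqrt (descent \<phi> a)" for a
  have fin: "finite (N u)" using assms finite_N by blast
  have s0: "0 \<le> s a" for a unfolding s_def by (simp add: descent_nonneg)
  have "(\<Sum>a\<in>N u. (s a)\<^sup>2) \<le> (\<Sum>a\<in>N u. 2 * (max 0 (\<phi> u - \<phi> a))\<^sup>2 + 2 * descent \<phi> a)"
  proof (rule sum_mono)
    fix a
    show "(s a)\<^sup>2 \<le> 2 * (max 0 (\<phi> u - \<phi> a))\<^sup>2 + 2 * descent \<phi> a"
      unfolding s_def
      using sum_squares_bound[of "max 0 (\<phi> u - \<phi> a)" "sqrt (descent \<phi> a)"] descent_nonneg[of \<phi> a]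
      by (simp add: power2_sum)
  qed
  \<comment> \<open>The drops from \<open>u\<close> to its neighbours make up the descent at \<open>u\<close>, and \<open>u\<close> is not its own neighbour.\<close>
  also have "\<dots> = 2 * (\<Sum>a\<in>insert u (N u). descent \<phi> a)"
    using fin N_irrefl[of u] by (simp add: sum.distrib sum_distrib_left descent_def)
  also have "\<dots> \<le> 2 * energy \<phi>"
    unfolding energy_def using assms N_subset finite_V
    by (intro mult_left_mono sum_mono2) (auto simp: descent_nonneg)
  finally have le: "(\<Sum>a\<in>N u. (s a)\<^sup>2) \<le> 2 * energy \<phi>" .
  have "\<exists>a\<in>N u. deg u * (s a)\<^sup>2 \<le> 2 * energy \<phi>"
  proof (rule ccontr)
    assume "\<not> ?thesis"
    then have "(\<Sum>a\<in>N u. 2 * energy \<phi>) < (\<Sum>a\<in>N u. deg u * (s a)\<^sup>2)"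
      using fin assms by (intro sum_strict_mono) auto
    also have "\<dots> \<le> deg u * (2 * energy \<phi>)"
      unfolding sum_distrib_left[symmetric] using le by (intro mult_left_mono) (auto simp: deg_def)
    finally show False by (simp add: deg_def)
  qed
  then obtain a where a: "a \<in> N u" "deg u * (s a)\<^sup>2 \<le> 2 * energy \<phi>" by blast
  have "\<phi> u - \<phi> a + sqrt (descent \<phi> a) \<le> s a"
    unfolding s_def by simp
  with a s0 show ?thesis using that by blast
qed


end

section \<open>Graphs of diameter at most two\<close>

locale diameter_two_graph = finite_graph +
  assumes diam2: "\<lbrakk>u \<in> V; v \<in> V; u \<noteq> v\<rbrakk> \<Longrightarrow> v \<in> N u \<or> (\<exists>w. w \<in> N u \<and> v \<in> N w)"
    and two_vertices: "\<exists>u\<in>V. \<exists>v\<in>V. u \<noteq> v"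
begin

lemma N_nonempty:
  assumes "x \<in> V" shows "N x \<noteq> {}"
proof -
  obtain v where "v \<in> V" "v \<noteq> x" using two_vertices by metis
  then show ?thesis using diam2[OF assms] by blast
qed

lemma deg_ge_1: "x \<in> V \<Longrightarrow> 1 \<le> deg x"
  using N_nonempty finite_N by (simp add: deg_def Suc_le_eq card_gt_0_iff)

lemma vol_pos: "0 < vol"
  unfolding vol_def using two_vertices finite_V deg_ge_1
  by (intro sum_pos) force+

text \<open>On a shortest path from \<open>a\<close> to \<open>b\<close> the first edge is charged to the arcs leaving \<open>a\<close> and the last one to
  the arcs entering \<open>b\<close>; the latter are the downhill arcs at \<open>b\<close> for the potential \<open>- \<phi>\<close>.\<close>

lemma drop_between:
  assumes "a \<in> V" "b \<in> V"
  shows "\<phi> a - \<phi> b \<le> sqrt (descent \<phi> a) + sqrt (descent (\<lambda>x. - \<phi> x) b)"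
proof -
  have nn: "0 \<le> sqrt (descent \<phi> a)" "0 \<le> sqrt (descent (\<lambda>x. - \<phi> x) b)"
    by (simp_all add: descent_nonneg)
  consider "a = b" | "b \<in> N a" | w where "w \<in> N a" "b \<in> N w"
    using diam2[OF assms] by blast
  then show ?thesis
  proof cases
    case 1
    then show ?thesis using nn by simp
  next
    case 2
    then show ?thesis using drop_le_descent[OF assms(1), of b \<phi>] nn by linarith
  next
    case 3
    have "\<phi> a - \<phi> w \<le> sqrt (descent \<phi> a)"
      using assms 3 by (intro drop_le_descent)
    moreover have "- \<phi> b - - \<phi> w \<le> sqrt (descent (\<lambda>x. - \<phi> x) b)"
      using assms 3 N_sym by (intro drop_le_descent) auto
    ultimately show ?thesis by simp
  qed
qed

text \<open>The effective resistance between \<open>u\<close> and \<open>v\<close> is the largest value of \<open>(\<phi> u - \<phi> v)\<^sup>2 / energy \<phi>\<close>, so this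
  says that it is at most \<open>4 * (1 / deg u + 1 / deg v)\<close>. Walk from \<open>u\<close> to a cheap neighbour \<open>a\<close>, from there
  to a cheap neighbour \<open>b\<close> of \<open>v\<close> by at most two edges, and on to \<open>v\<close>.\<close>

lemma resistance_bound:
  assumes u: "u \<in> V" and v: "v \<in> V"
  shows "deg u * deg v * (\<phi> u - \<phi> v)\<^sup>2 \<le> 4 * (deg u + deg v) * energy \<phi>"
proof -
  have main: "deg u * deg v * (\<phi> u - \<phi> v)\<^sup>2 \<le> 4 * (deg u + deg v) * energy \<phi>"
    if uv: "u \<in> V" "v \<in> V" and le: "\<phi> v \<le> \<phi> u" for u v
  proof -
    obtain a s where a: "a \<in> N u" "0 \<le> s" "\<phi> u - \<phi> a + sqrt (descent \<phi> a) \<le> s"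
      "deg u * s\<^sup>2 \<le> 2 * energy \<phi>"
      using cheap_neighbour[OF uv(1) N_nonempty[OF uv(1)]] by blast
    obtain b t where b: "b \<in> N v" "0 \<le> t"
      "- \<phi> v - - \<phi> b + sqrt (descent (\<lambda>x. - \<phi> x) b) \<le> t"
      "deg v * t\<^sup>2 \<le> 2 * energy (\<lambda>x. - \<phi> x)"
      using cheap_neighbour[OF uv(2) N_nonempty[OF uv(2)], of "\<lambda>x. - \<phi> x"] by blast
    have "\<phi> a - \<phi> b \<le> sqrt (descent \<phi> a) + sqrt (descent (\<lambda>x. - \<phi> x) b)"
      using a b uv N_in_V by (intro drop_between) blast+
    then have "\<phi> u - \<phi> v \<le> s + t" using a(3) b(3) by simp
    then have "(\<phi> u - \<phi> v)\<^sup>2 \<le> (s + t)\<^sup>2" using le by (intro power_mono) auto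
    also have "\<dots> \<le> 2 * s\<^sup>2 + 2 * t\<^sup>2"
      using sum_squares_bound[of s t] by (simp add: power2_sum)
    finally have "deg u * deg v * (\<phi> u - \<phi> v)\<^sup>2 \<le> deg u * deg v * (2 * s\<^sup>2 + 2 * t\<^sup>2)"
      by (intro mult_left_mono) (auto simp: deg_def)
    also have "\<dots> = 2 * deg v * (deg u * s\<^sup>2) + 2 * deg u * (deg v * t\<^sup>2)"
      by (simp add: algebra_simps)
    also have "\<dots> \<le> 2 * deg v * (2 * energy \<phi>) + 2 * deg u * (2 * energy \<phi>)"
      using a(4) b(4) by (intro add_mono mult_left_mono) (auto simp: deg_def energy_uminus)
    finally show ?thesis by (simp add: algebra_simps)
  qed
  show ?thesis
  proof (cases "\<phi> v \<le> \<phi> u")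
    case True
    then show ?thesis using main u v by blast
  next
    case False
    then show ?thesis using main[OF v u] by (simp add: power2_commute mult.commute add.commute)
  qed
qed

lemma harmonic_const:
  assumes "\<And>x. x \<in> V \<Longrightarrow> lap \<phi> x = 0" and "u \<in> V" "v \<in> V"
  shows "\<phi> u = \<phi> v"
proof -
  have "energy \<phi> = 0" unfolding green[symmetric] using assms(1) by simp
  then have "deg u * deg v * (\<phi> u - \<phi> v)\<^sup>2 \<le> 0"
    using resistance_bound[OF assms(2,3), of \<phi>] by simp
  moreover have "0 < deg u * deg v" using deg_ge_1 assms(2,3) by (smt (verit) mult_pos_pos)
  ultimately have "(\<phi> u - \<phi> v)\<^sup>2 \<le> 0" by (meson mult_pos_pos not_le)
  then show ?thesis by simp
qed

text \<open>Divided by \<open>deg x\<close>, the equation \<open>lap h x = deg x\<close> says that \<open>h x\<close> is one more than the average of \<open>h\<close>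
  over the neighbours of \<open>x\<close>: the equation obtained by conditioning the hitting time on the first step.\<close>

definition hitting_system :: "'a \<Rightarrow> ('a \<Rightarrow> real) \<Rightarrow> bool" where
  "hitting_system j h \<longleftrightarrow> h j = 0 \<and> (\<forall>x\<in>V. 0 \<le> h x) \<and> (\<forall>x\<in>V - {j}. lap h x = deg x)"



text \<open>An a priori bound: the energy of \<open>h\<close> is at most \<open>vol\<close> times its maximum, while by \<open>resistance_bound\<close>
  the square of the maximum, which is the drop from the maximum to \<open>h j = 0\<close>, is at most a constant times
  the energy. It makes the iteration in the next lemma converge.\<close>

lemma subsolution_bounded:
  assumes j: "j \<in> V" "h j = 0" and nn: "\<And>x. x \<in> V \<Longrightarrow> 0 \<le> h x"
    and sub: "\<And>x. x \<in> V \<Longrightarrow> x \<noteq> j \<Longrightarrow> lap h x \<le> deg x" and x: "x \<in> V"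
  shows "h x \<le> 8 * vol"
proof -
  define M where "M = Max (h ` V)"
  have M: "h y \<le> M" if "y \<in> V" for y
    unfolding M_def using that finite_V by simp
  have "M \<in> h ` V" unfolding M_def using x finite_V by (intro Max_in) auto
  then obtain u where u: "u \<in> V" "h u = M" by blast
  have "energy h = (\<Sum>y\<in>V. h y * lap h y)" by (rule green[symmetric])
  also have "\<dots> \<le> (\<Sum>y\<in>V. M * deg y)"
  proof (rule sum_mono)
    fix y assume y: "y \<in> V"
    show "h y * lap h y \<le> M * deg y"
    proof (cases "y = j")
      case True
      then show ?thesis using j M[OF j(1)] by (simp add: deg_def)
    next
      case False
      then have "h y * lap h y \<le> h y * deg y" using sub y nn by (intro mult_left_mono) auto
      also have "\<dots> \<le> M * deg y" using M y by (intro mult_right_mono) (auto simp: deg_def)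
      finally show ?thesis .
    qed
  qed
  also have "\<dots> = M * vol" by (simp add: vol_def sum_distrib_left)
  finally have E: "energy h \<le> M * vol" .
  have d: "1 \<le> deg u" "1 \<le> deg j" using u j deg_ge_1 by auto
  have "deg u * deg j * M\<^sup>2 \<le> 4 * (deg u + deg j) * energy h"
    using resistance_bound[OF u(1) j(1), of h] u j by simp
  also have "\<dots> \<le> 4 * (2 * (deg u * deg j)) * (M * vol)"
  proof (intro mult_mono E mult_left_mono)
    have "0 \<le> (deg u - 1) * deg j + deg u * (deg j - 1)" using d by simp
    then show "deg u + deg j \<le> 2 * (deg u * deg j)" by (simp add: algebra_simps)
  qed (use d energy_nonneg in auto)
  finally have "deg u * deg j * M\<^sup>2 \<le> deg u * deg j * (8 * vol * M)" by (simp add: algebra_simps)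
  then have "M * M \<le> 8 * vol * M"
    using d by (simp add: power2_eq_square mult_le_cancel_left)
  then have "M \<le> 8 * vol"
    using vol_pos nn[OF u(1)] u(2) by (cases "M = 0") (auto simp: mult_le_cancel_right)
  then show ?thesis using M[OF x] by simp
qed

text \<open>Iterating the one-step equations from \<open>0\<close> (which yields the expected hitting times truncated at \<open>n\<close>
  steps) gives an increasing sequence, bounded by the previous lemma, and its limit solves the equations.\<close>

lemma hitting_system_exists:
  assumes j: "j \<in> V"
  obtains h where "hitting_system j h"
proof -
  define F where "F h x = (if x = j then 0 else 1 + (\<Sum>y\<in>N x. h y) / deg x)" for h :: "'a \<Rightarrow> real" and x
  define H where "H n = (F ^^ n) (\<lambda>_. 0)" for n
  have H_Suc: "H (Suc n) = F (H n)" for n by (simp add: H_def)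
  have F_mono: "F h x \<le> F h' x" if "x \<in> V" "\<And>y. y \<in> V \<Longrightarrow> h y \<le> h' y" for h h' x
    unfolding F_def using that N_in_V by (auto intro!: divide_right_mono sum_mono simp: deg_def)
  have nn: "0 \<le> H n x" if "x \<in> V" for n x
    using that
  proof (induction n arbitrary: x)
    case 0
    then show ?case by (simp add: H_def)
  next
    case (Suc n)
    then show ?case unfolding H_Suc F_def using N_in_V
      by (auto intro!: add_nonneg_nonneg divide_nonneg_nonneg sum_nonneg simp: deg_def)
  qed
  have inc: "H n x \<le> H (Suc n) x" if "x \<in> V" for n x
    using that
  proof (induction n arbitrary: x)
    case 0
    then show ?case using nn[of x 1] by (simp add: H_def)
  next
    case (Suc n)
    then show ?case unfolding H_Suc[of "Suc n"] H_Suc[of n] by (intro F_mono) (auto simp: H_Suc)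
  qed
  have Hj: "H n j = 0" for n by (cases n) (auto simp: H_def F_def)
  have bound: "H n x \<le> 8 * vol" if x: "x \<in> V" for n x
  proof (rule subsolution_bounded[where h = "H n", OF j Hj nn _ x])
    fix y assume y: "y \<in> V" "y \<noteq> j"
    have "H n y \<le> 1 + (\<Sum>z\<in>N y. H n z) / deg y"
      using inc[OF y(1), of n] y(2) by (simp add: H_Suc F_def)
    then have "deg y * H n y \<le> deg y * (1 + (\<Sum>z\<in>N y. H n z) / deg y)"
      by (intro mult_left_mono) (auto simp: deg_def)
    then show "lap (H n) y \<le> deg y"
      using deg_ge_1[OF y(1)] by (simp add: lap_deg algebra_simps)
  qed
  define h where "h x = lim (\<lambda>n. H n x)" for x
  have lim: "(\<lambda>n. H n x) \<longlonglongrightarrow> h x" if x: "x \<in> V" for x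
  proof -
    have "incseq (\<lambda>n. H n x)" using inc[OF x] by (rule incseq_SucI)
    then obtain L where "(\<lambda>n. H n x) \<longlonglongrightarrow> L"
      using incseq_convergent[of "\<lambda>n. H n x"] bound[OF x] by blast
    then show ?thesis by (simp add: h_def limI)
  qed
  have "h j = 0" by (simp add: h_def Hj)
  moreover have "0 \<le> h x" if "x \<in> V" for x
    using LIMSEQ_le_const[OF lim[OF that]] nn[OF that] by blast
  moreover have "lap h x = deg x" if x: "x \<in> V" "x \<noteq> j" for x
  proof -
    have "(\<lambda>n. F (H n) x) \<longlonglongrightarrow> 1 + (\<Sum>y\<in>N x. h y) / deg x"
      unfolding F_def using x N_in_V deg_ge_1[OF x(1)] by (auto intro!: tendsto_intros lim)
    moreover have "(\<lambda>n. F (H n) x) \<longlonglongrightarrow> h x"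
      using LIMSEQ_Suc[OF lim[OF x(1)]] by (simp add: H_Suc)
    ultimately have "h x = 1 + (\<Sum>y\<in>N x. h y) / deg x" by (rule LIMSEQ_unique[rotated])
    then show ?thesis using deg_ge_1[OF x(1)] by (simp add: lap_deg field_simps)
  qed
  ultimately show ?thesis using that unfolding hitting_system_def by blast
qed

text \<open>The values of a Laplacian sum to zero, so the equations at the other vertices determine the one at the
  target. In terms of the walk, this is the formula \<open>vol / deg j\<close> for the expected return time.\<close>

lemma lap_at_target:
  assumes "hitting_system j h" "j \<in> V"
  shows "lap h j = deg j - vol"
proof -
  have "0 = lap h j + (\<Sum>x\<in>V - {j}. lap h x)"
    using sum_lap[of h] assms finite_V by (simp add: sum.remove)
  also have "(\<Sum>x\<in>V - {j}. lap h x) = vol - deg j"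
    using assms finite_V unfolding hitting_system_def vol_def by (simp add: sum_diff1)
  finally show ?thesis by simp
qed

lemma lap_diff: "lap (\<lambda>x. f x - g x) x = lap f x - lap g x"
  by (simp add: lap_def sum_subtractf right_diff_distrib)

text \<open>The function \<open>hv - hu\<close> is the potential of a current of strength \<open>vol\<close> from \<open>u\<close> to \<open>v\<close>, and the voltage
  between the two is the commute time \<open>c\<close>. Its energy is therefore \<open>vol * c\<close>, so the inequality for \<open>c\<^sup>2\<close>
  given by \<open>resistance_bound\<close> can be divided by \<open>c\<close>.\<close>

lemma commute_bound:
  assumes u: "u \<in> V" and v: "v \<in> V" and hu: "hitting_system u hu" and hv: "hitting_system v hv"
  shows "deg u * deg v * (hv u + hu v) \<le> 4 * vol * (deg u + deg v)"
proof (cases "hv u + hu v = 0")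
  case True
  then show ?thesis using vol_pos by (simp add: deg_def)
next
  case False
  let ?c = "hv u + hu v"
  let ?\<phi> = "\<lambda>x. hv x - hu x"
  have c: "0 < ?c" using False hu hv u v unfolding hitting_system_def by (smt (verit))
  have lap: "lap ?\<phi> x = vol * (of_bool (x = u) - of_bool (x = v))" if "x \<in> V" for x
    using that lap_at_target[OF hu u] lap_at_target[OF hv v] hu hv
    unfolding lap_diff hitting_system_def by (cases "x = u"; cases "x = v") auto
  have "energy ?\<phi> = (\<Sum>x\<in>V. ?\<phi> x * lap ?\<phi> x)" by (rule green[symmetric])
  also have "\<dots> = (\<Sum>x\<in>V. ?\<phi> x * (vol * (of_bool (x = u) - of_bool (x = v))))"
    by (intro sum.cong) (auto simp: lap)
  also have "\<dots> = vol * (?\<phi> u - ?\<phi> v)"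
  proof -
    have "(\<Sum>x\<in>V. ?\<phi> x * (vol * (of_bool (x = u) - of_bool (x = v))))
       = (\<Sum>x\<in>V. (if x = u then vol * ?\<phi> x else 0)) - (\<Sum>x\<in>V. (if x = v then vol * ?\<phi> x else 0))"
      unfolding sum_subtractf[symmetric] by (intro sum.cong) auto
    then show ?thesis using finite_V u v by (simp add: algebra_simps)
  qed
  also have eq: "?\<phi> u - ?\<phi> v = ?c" using hu hv unfolding hitting_system_def by simp
  finally have "energy ?\<phi> = vol * ?c" .
  then have "deg u * deg v * ?c\<^sup>2 \<le> 4 * (deg u + deg v) * (vol * ?c)"
    using resistance_bound[OF u v, of ?\<phi>] unfolding eq by simp
  then have "(deg u * deg v * ?c) * ?c \<le> (4 * vol * (deg u + deg v)) * ?c"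
    by (simp add: power2_eq_square algebra_simps)
  then show ?thesis using c by (simp only: mult_le_cancel_right_pos)
qed

text \<open>The weighted sum \<open>k\<close> of the hitting times is harmonic: the contributions \<open>deg j * deg x\<close> of all targets
  add up to \<open>vol * deg x\<close>, which the exceptional value at the target \<open>x\<close> cancels. So \<open>k\<close> is constant and may be
  averaged over the starting vertex with weights \<open>deg\<close>, which symmetrises hitting times into commute times.\<close>

lemma weighted_hitting_sum_bound:
  assumes h: "\<And>j. j \<in> V \<Longrightarrow> hitting_system j (h j)" and i: "i \<in> V"
  shows "(\<Sum>j\<in>V. deg j * h j i) \<le> 4 * (real (card V) - 1) * vol"
proof -
  define k where "k x = (\<Sum>j\<in>V. deg j * h j x)" for x
  have lap_h: "lap (h j) x = deg x - (if x = j then vol else 0)" if "j \<in> V" "x \<in> V" for j x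
    using h[OF that(1)] that lap_at_target[OF h[OF that(1)] that(1)]
    unfolding hitting_system_def by (cases "x = j") auto
  have "lap k x = 0" if x: "x \<in> V" for x
  proof -
    have "lap k x = (\<Sum>j\<in>V. deg j * lap (h j) x)"
      unfolding lap_def k_def sum_subtractf[symmetric] sum_distrib_left
      by (subst sum.swap) (simp add: algebra_simps)
    also have "\<dots> = (\<Sum>j\<in>V. deg j * deg x - (if x = j then deg j * vol else 0))"
      using x by (intro sum.cong) (auto simp: lap_h algebra_simps)
    also have "\<dots> = 0"
      using x finite_V by (simp add: sum_subtractf vol_def sum_distrib_right[symmetric] mult.commute)
    finally show ?thesis .
  qed
  then have const: "k x = k i" if "x \<in> V" for x
    using harmonic_const[of k, OF _ that i] by blast
  have "2 * (vol * k i) = 2 * (\<Sum>x\<in>V. deg x * k x)"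
    using const by (simp add: vol_def sum_distrib_right)
  also have "\<dots> = (\<Sum>x\<in>V. \<Sum>j\<in>V. deg x * deg j * h j x) + (\<Sum>x\<in>V. \<Sum>j\<in>V. deg x * deg j * h x j)"
  proof -
    have "(\<Sum>x\<in>V. deg x * k x) = (\<Sum>x\<in>V. \<Sum>j\<in>V. deg x * deg j * h j x)"
      by (simp add: k_def sum_distrib_left mult.assoc)
    moreover have "(\<Sum>x\<in>V. \<Sum>j\<in>V. deg x * deg j * h j x) = (\<Sum>x\<in>V. \<Sum>j\<in>V. deg x * deg j * h x j)"
      by (subst sum.swap) (simp add: mult_ac)
    ultimately show ?thesis by simp
  qed
  also have "\<dots> = (\<Sum>x\<in>V. \<Sum>j\<in>V. deg x * deg j * (h j x + h x j))"
    by (simp add: sum.distrib algebra_simps)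
  \<comment> \<open>The diagonal terms vanish; removing them on the right turns the factor \<open>n\<close> into \<open>n - 1\<close>.\<close>
  also have "\<dots> \<le> (\<Sum>x\<in>V. \<Sum>j\<in>V. 4 * vol * (deg x + deg j) - (if x = j then 8 * vol * deg x else 0))"
  proof (intro sum_mono)
    fix x j assume xj: "x \<in> V" "j \<in> V"
    show "deg x * deg j * (h j x + h x j) \<le> 4 * vol * (deg x + deg j) - (if x = j then 8 * vol * deg x else 0)"
    proof (cases "x = j")
      case True
      then show ?thesis using h[OF xj(2)] unfolding hitting_system_def by simp
    next
      case False
      then show ?thesis using commute_bound[OF xj h[OF xj(1)] h[OF xj(2)]] by simp
    qed
  qed
  also have "\<dots> = 8 * vol * (real (card V) - 1) * vol"
  proof -
    have *: "(\<Sum>x\<in>V. \<Sum>j\<in>V. if x = j then 8 * vol * deg x else 0) = 8 * vol * vol"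
      using finite_V by (simp add: vol_def sum_distrib_left)
    have "(\<Sum>x\<in>V. \<Sum>j\<in>V. 4 * vol * (deg x + deg j)) = 4 * vol * (\<Sum>x\<in>V. \<Sum>j\<in>V. deg x + deg j)"
      by (simp only: sum_distrib_left)
    also have "(\<Sum>x\<in>V. \<Sum>j\<in>V. deg x + deg j) = 2 * real (card V) * vol"
      by (simp add: sum.distrib vol_def sum_distrib_left[symmetric])
    finally show ?thesis unfolding sum_subtractf * by (simp add: algebra_simps)
  qed
  finally have "vol * k i \<le> vol * (4 * (real (card V) - 1) * vol)" by (simp add: algebra_simps)
  then show ?thesis using vol_pos unfolding k_def by (simp only: mult_le_cancel_left_pos)
qed

end

section \<open>Hitting times of the random walk\<close>

lemma sum_PiE_insert:
  assumes "k \<notin> S"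
  shows "(\<Sum>x\<in>PiE (insert k S) (\<lambda>_. U). f x) = (\<Sum>y\<in>U. \<Sum>g\<in>PiE S (\<lambda>_. U). f (g(k := y)))"
proof -
  have "(\<Sum>x\<in>PiE (insert k S) (\<lambda>_. U). f x) =
      (\<Sum>p\<in>U \<times> PiE S (\<lambda>_. U). f ((\<lambda>(y, g). g(k := y)) p))"
    unfolding PiE_insert_eq by (rule sum.reindex[unfolded o_def]) (rule inj_combinator[OF assms])
  then show ?thesis by (simp add: sum.cartesian_product case_prod_beta)
qed

context
  fixes G :: "'a pair_pre_digraph" and V :: "'a set" and i :: 'a
  assumes finite_graph: "finite_graph V (neighbours G)"
    and no_isolated: "\<And>x. x \<in> V \<Longrightarrow> neighbours G x \<noteq> {}"
    and start: "i \<in> V"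
begin

interpretation finite_graph V "neighbours G" by (rule finite_graph)

abbreviation step_prob :: "'a \<Rightarrow> 'a \<Rightarrow> real" where
  "step_prob x y \<equiv> pmf (pmf_of_set (neighbours G x)) y"

definition path_weight :: "nat \<Rightarrow> (nat \<Rightarrow> 'a) \<Rightarrow> real" where
  "path_weight n x = of_bool (x 0 = i) * (\<Prod>k<n. step_prob (x k) (x (Suc k)))"

text \<open>The expectation of \<open>\<phi>\<close> at the position at time \<open>n\<close>, restricted to the event that the walk from \<open>i\<close> has
  not left \<open>U\<close> up to time \<open>n\<close>, written as a finite sum over the paths in \<open>U\<close>.\<close>

definition killed_expectation :: "'a set \<Rightarrow> nat \<Rightarrow> ('a \<Rightarrow> real) \<Rightarrow> real" where
  "killed_expectation U n \<phi> = (\<Sum>x\<in>PiE {..n} (\<lambda>_. U). path_weight n x * \<phi> (x n))"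

text \<open>The set \<open>U\<close> may miss neighbours of \<open>x\<close> where \<open>\<phi>\<close> vanishes, such as the target of a hitting system.\<close>

lemma sum_step_prob:
  assumes "x \<in> V" "neighbours G x \<inter> V \<subseteq> U \<union> {y. \<phi> y = 0}" "U \<subseteq> V"
  shows "(\<Sum>y\<in>U. step_prob x y * \<phi> y) = (\<Sum>y\<in>neighbours G x. \<phi> y) / deg x"
proof -
  have "(\<Sum>y\<in>U. step_prob x y * \<phi> y) = (\<Sum>y\<in>neighbours G x. \<phi> y / deg x)"
    using assms N_in_V no_isolated[OF assms(1)] finite_N[OF assms(1)] finite_subset[OF assms(3) finite_V]
    by (intro sum.mono_neutral_cong) (auto simp: deg_def pmf_of_set indicator_def)
  then show ?thesis by (simp add: sum_divide_distrib)
qed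

lemma killed_expectation_0:
  assumes "finite U"
  shows "killed_expectation U 0 \<phi> = (if i \<in> U then \<phi> i else 0)"
proof -
  have "killed_expectation U 0 \<phi> = (\<Sum>y\<in>U. if y = i then \<phi> i else 0)"
    unfolding killed_expectation_def atMost_0 sum_PiE_insert[of "0::nat" "{}", simplified]
    by (intro sum.cong) (auto simp: path_weight_def)
  then show ?thesis using assms by simp
qed

text \<open>The Markov property, in the form that conditions on the last step.\<close>

lemma killed_expectation_Suc:
  "killed_expectation U (Suc n) \<phi> = killed_expectation U n (\<lambda>x. \<Sum>y\<in>U. step_prob x y * \<phi> y)"
proof -
  have w: "path_weight (Suc n) (g(Suc n := y)) = path_weight n g * step_prob (g n) y" for g y
    unfolding path_weight_def prod.lessThan_Suc by (auto intro!: prod.cong)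
  have "killed_expectation U (Suc n) \<phi> =
      (\<Sum>y\<in>U. \<Sum>g\<in>PiE {..n} (\<lambda>_. U). path_weight n g * step_prob (g n) y * \<phi> y)"
    unfolding killed_expectation_def atMost_Suc by (subst sum_PiE_insert) (simp_all add: w)
  also have "\<dots> = killed_expectation U n (\<lambda>x. \<Sum>y\<in>U. step_prob x y * \<phi> y)"
    unfolding killed_expectation_def by (subst sum.swap) (simp add: sum_distrib_left mult.assoc)
  finally show ?thesis .
qed

lemma killed_expectation_cong:
  "(\<And>x. x \<in> U \<Longrightarrow> \<phi> x = \<psi> x) \<Longrightarrow> killed_expectation U n \<phi> = killed_expectation U n \<psi>"
  unfolding killed_expectation_def by (intro sum.cong) (auto simp: PiE_iff)

lemma path_weight_nonneg: "0 \<le> path_weight n x"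
  unfolding path_weight_def by (intro mult_nonneg_nonneg prod_nonneg) auto

lemma killed_expectation_nonneg:
  "(\<And>x. x \<in> U \<Longrightarrow> 0 \<le> \<phi> x) \<Longrightarrow> 0 \<le> killed_expectation U n \<phi>"
  unfolding killed_expectation_def by (intro sum_nonneg mult_nonneg_nonneg path_weight_nonneg) (auto simp: PiE_iff)

lemma killed_expectation_total: "killed_expectation V n (\<lambda>_. 1) = 1"
proof (induction n)
  case 0
  then show ?case using start finite_V by (simp add: killed_expectation_0)
next
  case (Suc n)
  have "killed_expectation V (Suc n) (\<lambda>_. 1) = killed_expectation V n (\<lambda>_. 1)"
    unfolding killed_expectation_Suc
  proof (rule killed_expectation_cong)
    fix x assume x: "x \<in> V"
    show "(\<Sum>y\<in>V. step_prob x y * 1) = 1"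
      using no_isolated[OF x] finite_N[OF x] by (subst sum_step_prob[OF x]) (auto simp: deg_def)
  qed
  with Suc show ?case by simp
qed

lemma measurable_position: "(\<lambda>\<omega>. \<omega> k) \<in> measurable (srw G i) (count_space UNIV)"
  unfolding measurable_cong_sets[OF sets_srw refl] by (rule measurable_component_singleton) simp

lemma space_srw: "space (srw G i) = UNIV"
  using sets_eq_imp_space_eq[OF sets_srw, of G i] by (simp add: space_PiM)

text \<open>The marginal on the empty set of times is a probability measure on a one-point space, and the whole
  space of trajectories is the cylinder over it.\<close>

lemma emeasure_srw_UNIV: "emeasure (srw G i) UNIV = 1"
proof -
  let ?M = "\<lambda>_ :: nat. count_space (UNIV :: 'a set)"
  interpret Ionescu_Tulcea "srw_kernel G i" ?M
    by (rule Ionescu_Tulcea_srw_kernel)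
  interpret CI: prob_space "CI {}" by (rule PF.prob_space_P) auto
  have "prod_emb UNIV ?M {} (space (PiM {} ?M)) = UNIV"
    by (auto simp: prod_emb_def space_PiM)
  then have "emeasure (srw G i) UNIV = emeasure (CI {}) (space (PiM {} ?M))"
    using lim[of "{}" "space (PiM {} ?M)"] unfolding srw_def by simp
  also have "space (PiM {} ?M) = space (CI {})"
    by (rule sets_eq_imp_space_eq) (simp add: PF.sets_P)
  finally show ?thesis by (simp add: CI.emeasure_space_1)
qed

lemma prob_space_srw: "prob_space (srw G i)"
  by (rule prob_spaceI) (simp add: space_srw emeasure_srw_UNIV)

lemma emeasure_srw_stay:
  assumes "finite U"
  shows "emeasure (srw G i) {\<omega>. \<forall>k\<le>n. \<omega> k \<in> U} = ennreal (killed_expectation U n (\<lambda>_. 1))"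
proof -
  let ?P = "PiE {..n} (\<lambda>_. U)"
  let ?C = "\<lambda>x. {\<omega>. \<forall>k<Suc n. \<omega> k = x k}"
  note measurable_position[measurable]
  have fin: "finite ?P" using assms by (intro finite_PiE) auto
  have C: "?C x \<in> sets (srw G i)" for x
  proof -
    have "{\<omega> \<in> space (srw G i). \<forall>k<Suc n. \<omega> k = x k} \<in> sets (srw G i)" by measurable
    then show ?thesis by (simp add: space_srw)
  qed
  have disj: "disjoint_family_on ?C ?P"
    unfolding disjoint_family_on_def
  proof (intro ballI impI)
    fix x y assume xy: "x \<in> ?P" "y \<in> ?P" "x \<noteq> y"
    obtain k where "k \<le> n" "x k \<noteq> y k"
      using PiE_ext[OF xy(1,2)] xy(3) by auto
    then show "?C x \<inter> ?C y = {}" by (auto simp: less_Suc_eq_le)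
  qed
  have "{\<omega>. \<forall>k\<le>n. \<omega> k \<in> U} = (\<Union>x\<in>?P. ?C x)"
  proof (intro set_eqI iffI)
    fix \<omega> assume "\<omega> \<in> {\<omega>. \<forall>k\<le>n. \<omega> k \<in> U}"
    then have "restrict \<omega> {..n} \<in> ?P" "\<omega> \<in> ?C (restrict \<omega> {..n})" by auto
    then show "\<omega> \<in> (\<Union>x\<in>?P. ?C x)" by blast
  qed (auto simp: PiE_iff less_Suc_eq_le)
  then have "emeasure (srw G i) {\<omega>. \<forall>k\<le>n. \<omega> k \<in> U} = emeasure (srw G i) (\<Union>x\<in>?P. ?C x)"
    by (rule arg_cong)
  also have "\<dots> = (\<Sum>x\<in>?P. emeasure (srw G i) (?C x))"
    by (rule sum_emeasure[OF _ disj fin, symmetric]) (use C in blast)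
  also have "\<dots> = (\<Sum>x\<in>?P. ennreal (path_weight n x))"
    unfolding emeasure_srw_path path_weight_def ..
  also have "\<dots> = ennreal (killed_expectation U n (\<lambda>_. 1))"
    by (simp add: killed_expectation_def sum_ennreal path_weight_nonneg)
  finally show ?thesis .
qed

text \<open>The vertex type may be uncountable, so the finite path sums only see trajectories inside \<open>V\<close>. Their
  weights already add up to one, so almost no trajectory is lost.\<close>

lemma AE_srw_in_V: "AE \<omega> in srw G i. \<forall>n. \<omega> n \<in> V"
proof -
  interpret prob_space "srw G i" by (rule prob_space_srw)
  note measurable_position[measurable]
  have "AE \<omega> in srw G i. \<omega> n \<in> V" for n
  proof -
    have "AE \<omega> in srw G i. \<forall>k\<le>n. \<omega> k \<in> V"
    proof (rule AE_I_eq_1)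
      have V [measurable]: "V \<in> sets (count_space UNIV)" by simp
      show "{\<omega> \<in> space (srw G i). \<forall>k\<le>n. \<omega> k \<in> V} \<in> sets (srw G i)" by measurable
      show "emeasure (srw G i) {\<omega> \<in> space (srw G i). \<forall>k\<le>n. \<omega> k \<in> V} = 1"
        using emeasure_srw_stay[OF finite_V, of n] killed_expectation_total[of n] by (simp add: space_srw)
    qed
    then show ?thesis by eventually_elim simp
  qed
  then show ?thesis by (simp add: AE_all_countable)
qed

text \<open>The hitting time counts the times at which \<open>j\<close> has not been visited yet.\<close>

lemma hitting_time_le_survival_sum:
  "hitting_time j \<omega> \<le> (\<Sum>n. indicator {\<omega>. \<forall>k\<le>n. \<omega> k \<noteq> j} \<omega> :: ennreal)"
proof (cases "\<exists>n. \<omega> n = j")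
  case True
  define T where "T = (LEAST n. \<omega> n = j)"
  have T: "\<omega> T = j" unfolding T_def using True by (rule LeastI_ex)
  have before: "\<omega> k \<noteq> j" if "k < T" for k
    using that unfolding T_def by (rule not_less_Least)
  have "hitting_time j \<omega> \<le> of_nat T"
    unfolding hitting_time_def using T by (intro INF_lower) auto
  also have "\<dots> = (\<Sum>n<T. indicator {\<omega>. \<forall>k\<le>n. \<omega> k \<noteq> j} \<omega>)"
    using before by (simp add: indicator_def)
  also have "\<dots> \<le> (\<Sum>n. indicator {\<omega>. \<forall>k\<le>n. \<omega> k \<noteq> j} \<omega>)"
    by (rule sum_le_suminf) auto
  finally show ?thesis .
next
  case False
  then have "(\<Sum>n. indicator {\<omega>. \<forall>k\<le>n. \<omega> k \<noteq> j} \<omega> :: ennreal) = (\<Sum>n. 1)" by simp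
  also have "\<dots> = \<top>" by (simp add: suminf_eq_SUP ennreal_SUP_of_nat_eq_top)
  finally show ?thesis by simp
qed

text \<open>Along the walk killed at \<open>j\<close>, each further step lowers the expectation of \<open>h\<close> by exactly the probability
  of having survived so far. Since the expectation starts at \<open>h i\<close> and stays nonnegative, the survival
  probabilities, whose sum is the expected hitting time, add up to at most \<open>h i\<close>.\<close>

lemma expected_hitting_time_le:
  assumes j: "j \<in> V" and hj: "h j = 0" and nn: "\<And>x. x \<in> V \<Longrightarrow> 0 \<le> h x"
    and lap: "\<And>x. x \<in> V \<Longrightarrow> x \<noteq> j \<Longrightarrow> lap h x = deg x"
  shows "expected_hitting_time G i j \<le> ennreal (h i)"
proof -
  let ?U = "V - {j}"
  let ?q = "\<lambda>n. killed_expectation ?U n (\<lambda>_. 1)"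
  have fin: "finite ?U" using finite_V by simp
  note measurable_position[measurable]
  have step: "killed_expectation ?U (Suc n) h = killed_expectation ?U n h - ?q n" for n
  proof -
    have "killed_expectation ?U (Suc n) h = killed_expectation ?U n (\<lambda>x. h x - 1)"
      unfolding killed_expectation_Suc
    proof (rule killed_expectation_cong)
      fix x assume x: "x \<in> ?U"
      have d: "0 < deg x" using no_isolated finite_N x by (auto simp: deg_def card_gt_0_iff)
      have "(\<Sum>y\<in>?U. step_prob x y * h y) = (\<Sum>y\<in>neighbours G x. h y) / deg x"
        using x hj by (intro sum_step_prob) auto
      also have "\<dots> = h x - 1" using lap[of x] x d by (simp add: lap_deg field_simps)
      finally show "(\<Sum>y\<in>?U. step_prob x y * h y) = h x - 1" .
    qed
    then show ?thesis by (simp add: killed_expectation_def right_diff_distrib sum_subtractf)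
  qed
  \<comment> \<open>For \<open>i = j\<close> the case \<open>N = 0\<close> holds because both sides are \<open>0\<close>: the walk is killed at time \<open>0\<close>, and \<open>h j = 0\<close>.\<close>
  have partial: "(\<Sum>n<N. ?q n) = h i - killed_expectation ?U N h" for N
  proof (induction N)
    case 0
    then show ?case using killed_expectation_0[OF fin, of h] start hj by auto
  next
    case (Suc N)
    then show ?case by (simp add: step)
  qed
  have "expected_hitting_time G i j \<le>
      (\<integral>\<^sup>+\<omega>. (\<Sum>n. indicator {\<omega>. \<forall>k\<le>n. \<omega> k \<noteq> j} \<omega>) \<partial>srw G i)"
    unfolding expected_hitting_time_def by (intro nn_integral_mono hitting_time_le_survival_sum)
  also have "\<dots> = (\<integral>\<^sup>+\<omega>. (\<Sum>n. indicator {\<omega>. \<forall>k\<le>n. \<omega> k \<in> ?U} \<omega>) \<partial>srw G i)"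
  proof (rule nn_integral_cong_AE)
    show "AE \<omega> in srw G i. (\<Sum>n. indicator {\<omega>. \<forall>k\<le>n. \<omega> k \<noteq> j} \<omega> :: ennreal) =
        (\<Sum>n. indicator {\<omega>. \<forall>k\<le>n. \<omega> k \<in> ?U} \<omega>)"
      using AE_srw_in_V by eventually_elim (simp add: indicator_def)
  qed
  also have "\<dots> = (\<Sum>n. \<integral>\<^sup>+\<omega>. indicator {\<omega>. \<forall>k\<le>n. \<omega> k \<in> ?U} \<omega> \<partial>srw G i)"
  proof (rule nn_integral_suminf)
    fix n
    have U [measurable]: "?U \<in> sets (count_space UNIV)" by simp
    have "{\<omega> \<in> space (srw G i). \<forall>k\<le>n. \<omega> k \<in> ?U} \<in> sets (srw G i)" by measurable
    then show "indicator {\<omega>. \<forall>k\<le>n. \<omega> k \<in> ?U} \<in> borel_measurable (srw G i)"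
      by (intro borel_measurable_indicator) (simp add: space_srw)
  qed
  also have "\<dots> = (\<Sum>n. ennreal (?q n))"
  proof (intro suminf_cong)
    fix n
    have U [measurable]: "?U \<in> sets (count_space UNIV)" by simp
    have "{\<omega> \<in> space (srw G i). \<forall>k\<le>n. \<omega> k \<in> ?U} \<in> sets (srw G i)" by measurable
    then show "(\<integral>\<^sup>+\<omega>. indicator {\<omega>. \<forall>k\<le>n. \<omega> k \<in> ?U} \<omega> \<partial>srw G i) = ennreal (?q n)"
      using emeasure_srw_stay[OF fin, of n] by (simp add: space_srw)
  qed
  also have "\<dots> \<le> ennreal (h i)"
  proof (rule suminf_le_const)
    fix N
    have "(\<Sum>n<N. ennreal (?q n)) = ennreal (\<Sum>n<N. ?q n)"
      by (intro sum_ennreal killed_expectation_nonneg) simp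
    also have "\<dots> \<le> ennreal (h i)"
      using killed_expectation_nonneg[of ?U h N] nn by (intro ennreal_leI) (simp add: partial)
    finally show "(\<Sum>n<N. ennreal (?q n)) \<le> ennreal (h i)" .
  qed simp
  finally show ?thesis .
qed

end

section \<open>Graphs of diameter two as pair digraphs\<close>

lemma diameter_two_graph_neighbours:
  assumes "pair_graph G" and diam: "graph_diam G = 2"
  shows "diameter_two_graph (pverts G) (neighbours G)"
proof -
  interpret pair_graph G by fact
  have dist: "graph_dist G u v = (INF p\<in>{p. awalk u p v}. ereal (real (length p)))" for u v
    unfolding graph_dist_def \<mu>_def by (simp add: awalk_cost_def sum_list_triv)
  show ?thesis
  proof
    show "finite (pverts G)" by simp
    show "x \<in> pverts G \<Longrightarrow> neighbours G x \<subseteq> pverts G" for x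
      by (auto simp: neighbours_def dest: in_arcsD2)
    show "y \<in> neighbours G x \<Longrightarrow> x \<in> neighbours G y" for x y
      unfolding neighbours_def using arcs_symmetric by blast
    show "x \<notin> neighbours G x" for x
      using no_loops' by (auto simp: neighbours_def)
  next
    fix u v assume uv: "u \<in> pverts G" "v \<in> pverts G" "u \<noteq> v"
    have "graph_dist G u v \<le> graph_diam G"
      unfolding graph_diam_def using uv by (intro SUP_upper2[of "(u, v)"]) auto
    also have "\<dots> < 3" unfolding diam by simp
    \<comment> \<open>An infimum of walk lengths that is below \<open>3\<close> is undercut by an actual walk of length below \<open>3\<close>.\<close>
    finally obtain p where p: "awalk u p v" "length p < 3"
      unfolding dist by (auto simp: INF_less_iff)
    then consider "p = []" | e where "p = [e]" | e f where "p = [e, f]"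
      by (cases p rule: remdups_adj.cases) auto
    then show "v \<in> neighbours G u \<or> (\<exists>w. w \<in> neighbours G u \<and> v \<in> neighbours G w)"
      using p(1) uv(3) by cases (auto simp: awalk_def neighbours_def)
  next
    show "\<exists>u\<in>pverts G. \<exists>v\<in>pverts G. u \<noteq> v"
    proof (rule ccontr)
      assume single: "\<not> ?thesis"
      \<comment> \<open>The empty walk would give a one-vertex graph diameter at most \<open>0\<close>.\<close>
      have "graph_dist G u v \<le> 0" if "u \<in> pverts G" "v \<in> pverts G" for u v
      proof -
        have "awalk u [] v" using single that by (auto simp: awalk_Nil_iff)
        then show ?thesis unfolding dist by (intro INF_lower2[of "[]"]) auto
      qed
      then have "graph_diam G \<le> 0" unfolding graph_diam_def by (auto intro!: SUP_least)
      then show False unfolding diam by simp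
    qed
  qed
qed

lemma out_degree_eq_card_neighbours: "out_degree (with_proj G) x = card (neighbours G x)"
proof -
  have "out_arcs (with_proj G) x = Pair x ` neighbours G x"
    by (auto simp: out_arcs_def neighbours_def)
  then show ?thesis by (simp add: out_degree_def card_image inj_on_def)
qed

lemma pair_graph_facts:
  assumes "pair_graph G"
  shows "finite (pverts G)" "finite (parcs G)" "parcs G \<subseteq> pverts G \<times> pverts G"
    "sym (parcs G)" "irrefl (parcs G)"
proof -
  interpret pair_graph G by fact
  show "finite (pverts G)" by (rule pair_finite_verts)
  show "finite (parcs G)" by (rule pair_finite_arcs)
  show "parcs G \<subseteq> pverts G \<times> pverts G" by (auto dest: in_arcsD1 in_arcsD2)
  show "sym (parcs G)" by (rule symI) (rule arcs_symmetric)
  show "irrefl (parcs G)" unfolding irrefl_def using no_loops' by blast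
qed

text \<open>Two arcs, opposite to each other and distinct by looplessness, carry each edge.\<close>

lemma handshake:
  assumes "pair_graph G"
  shows "2 * card (edge_set G) = (\<Sum>x\<in>pverts G. card (neighbours G x))"
proof -
  note facts = pair_graph_facts[OF assms]
  let ?e = "\<lambda>(u, v). {u, v}"
  have edges: "edge_set G = ?e ` parcs G" by (auto simp: edge_set_def)
  have two: "card {a \<in> parcs G. ?e a = e} = 2" if "e \<in> edge_set G" for e
  proof -
    from that obtain u v where uv: "e = {u, v}" "(u, v) \<in> parcs G" by (auto simp: edge_set_def)
    have vu: "(v, u) \<in> parcs G" using facts(4) uv(2) by (rule symD)
    have "?e a = e \<longleftrightarrow> a = (u, v) \<or> a = (v, u)" for a
      unfolding uv(1) by (cases a) (simp add: doubleton_eq_iff)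
    then have "{a \<in> parcs G. ?e a = e} = {a \<in> parcs G. a = (u, v) \<or> a = (v, u)}"
      by (simp only:)
    also have "\<dots> = {(u, v), (v, u)}" using uv(2) vu by auto
    finally have "{a \<in> parcs G. ?e a = e} = {(u, v), (v, u)}" .
    moreover have "u \<noteq> v" using facts(5) uv(2) by (auto simp: irrefl_def)
    ultimately show ?thesis by simp
  qed
  have "card (parcs G) = (\<Sum>e\<in>edge_set G. card {a \<in> parcs G. ?e a = e})"
    unfolding edges using sum.image_gen[OF facts(2), of "\<lambda>_. 1::nat" ?e] by simp
  also have "\<dots> = 2 * card (edge_set G)" by (simp add: two)
  finally have "2 * card (edge_set G) = card (parcs G)" by simp
  also have "parcs G = Sigma (pverts G) (neighbours G)"
    using facts(3) by (auto simp: neighbours_def)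
  also have "card \<dots> = (\<Sum>x\<in>pverts G. card (neighbours G x))"
  proof (rule card_SigmaI[OF facts(1)], intro ballI)
    fix x
    show "finite (neighbours G x)"
      using facts(3) by (intro finite_subset[OF _ facts(1)]) (auto simp: neighbours_def)
  qed
  finally show ?thesis .
qed

theorem kemeny_diameter_two_le:
  assumes "pair_graph G" "graph_diam G = 2" and i: "i \<in> pverts G"
  shows "kemeny G i \<le> ennreal (4 * (real (card (pverts G)) - 1))"
proof -
  interpret diameter_two_graph "pverts G" "neighbours G"
    using assms by (intro diameter_two_graph_neighbours)
  have "\<forall>j. \<exists>h. j \<in> pverts G \<longrightarrow> hitting_system j h"
    using hitting_system_exists by metis
  then obtain h where h: "\<And>j. j \<in> pverts G \<Longrightarrow> hitting_system j (h j)" by metis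
  have hit: "expected_hitting_time G i j \<le> ennreal (h j i)" if j: "j \<in> pverts G" for j
    using h[OF j] j i N_nonempty finite_graph_axioms unfolding hitting_system_def
    by (intro expected_hitting_time_le[of "pverts G"]) auto
  have vol: "2 * real (card (edge_set G)) = vol"
    using arg_cong[OF handshake[OF assms(1)], of real] by (simp add: vol_def deg_def)
  have "kemeny G i \<le> (\<Sum>j\<in>pverts G. ennreal (deg j / vol) * ennreal (h j i))"
    unfolding kemeny_def vol out_degree_eq_card_neighbours deg_def[symmetric]
    by (intro sum_mono mult_left_mono hit) auto
  also have "\<dots> = (\<Sum>j\<in>pverts G. ennreal (deg j / vol * h j i))"
    using vol_pos h i by (intro sum.cong refl ennreal_mult[symmetric])
      (auto simp: deg_def hitting_system_def)
  also have "\<dots> = ennreal (\<Sum>j\<in>pverts G. deg j / vol * h j i)"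
    using vol_pos h i by (intro sum_ennreal) (auto simp: deg_def hitting_system_def)
  also have "\<dots> \<le> ennreal (4 * (real (card (pverts G)) - 1))"
  proof (rule ennreal_leI)
    have "(\<Sum>j\<in>pverts G. deg j / vol * h j i) = (\<Sum>j\<in>pverts G. deg j * h j i) / vol"
      by (simp add: sum_divide_distrib)
    then show "(\<Sum>j\<in>pverts G. deg j / vol * h j i) \<le> 4 * (real (card (pverts G)) - 1)"
      using weighted_hitting_sum_bound[of h, OF h i] vol_pos by (simp add: divide_le_eq)
  qed
  finally show ?thesis .
qed

theorem corollary4p2:
  shows "(\<forall>(G :: 'a pair_pre_digraph) i.
            pair_graph G \<and> Digraph_Component.connected G \<and> graph_diam G = 2 \<and> i \<in> pverts G \<longrightarrow>
            kemeny G i \<le> ennreal ((3 + sqrt 5) * (real (card (pverts G)) - 1)))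
       \<and> (\<exists>C :: real. \<forall>(G :: 'a pair_pre_digraph) i.
            pair_graph G \<and> Digraph_Component.connected G \<and> graph_diam G = 2 \<and> i \<in> pverts G \<longrightarrow>
            kemeny G i \<le> ennreal (C * real (card (pverts G))))"
proof -
  have main: "kemeny G i \<le> ennreal (4 * (real (card (pverts G)) - 1))"
    if "pair_graph G \<and> Digraph_Component.connected G \<and> graph_diam G = 2 \<and> i \<in> pverts G"
    for G :: "'a pair_pre_digraph" and i
    using that by (elim conjE) (rule kemeny_diameter_two_le)
  have "kemeny G i \<le> ennreal ((3 + sqrt 5) * (real (card (pverts G)) - 1))"
    if G: "pair_graph G \<and> Digraph_Component.connected G \<and> graph_diam G = 2 \<and> i \<in> pverts G"
    for G :: "'a pair_pre_digraph" and i
  proof -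
    have "pverts G \<noteq> {}" using G by auto
    then have card: "1 \<le> real (card (pverts G))"
      using pair_graph_facts(1)[of G] G by (simp add: Suc_le_eq card_gt_0_iff)
    have "4 \<le> 3 + sqrt 5" using real_le_rsqrt[of 1 5] by simp
    then have "4 * (real (card (pverts G)) - 1) \<le> (3 + sqrt 5) * (real (card (pverts G)) - 1)"
      using card by (intro mult_right_mono) auto
    then show ?thesis
      using main[OF G] by (meson ennreal_leI order_trans)
  qed
  moreover have "kemeny G i \<le> ennreal (4 * real (card (pverts G)))"
    if G: "pair_graph G \<and> Digraph_Component.connected G \<and> graph_diam G = 2 \<and> i \<in> pverts G"
    for G :: "'a pair_pre_digraph" and i
    by (rule order_trans[OF main[OF G]]) (rule ennreal_leI, simp)
  ultimately show ?thesis by blast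
qed

end
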